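(* Let $\mathbf{d}$ and $\mathbf{e}$ be distances on a set $X$ and let $(x_\lambda)\subseteq X$ be a $\mathbf{d}$-Cauchy net. Suppose $X$ is $\mathbf{e}$-complete and $\mathbf{e}\circ\Phi^{\mathbf{d}}\precapprox\mathbf{d}\precapprox\mathbf{e}=\mathbf{e}^{\mathrm{op}}$. Then $\mathbf{e}\circ\Phi^{\mathbf{d}}=\mathbf{e}\circ{\leq^{\mathbf{d}}}$, and there is a $\mathbf{d}$-directed $Y\subseteq X$ with $$Y\mathbf{d}=(x_\lambda)\mathbf{d}\qquad\text{and}\qquad\mathbf{d}Y=\mathbf{d}(x_\lambda),$$ that is, for all $z\in X$, $\sup_{y\in Y}\mathbf{d}(y,z)=\lim_\lambda\mathbf{d}(x_\lambda,z)$ and $\inf_{y\in Y}\mathbf{d}(z,y)=\lim_\lambda\mathbf{d}(z,x_\lambda)$. If, moreover, $X$ is $\mathbf{e}$-separable, then $Y$ can be chosen to be $\leq^{\mathbf{d}}$-directed.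
   Context: A distance on $X$ is a function $\mathbf{d}:X\times X\to[0,\infty]$ with $\mathbf{d}(x,y)\leq\mathbf{d}(x,z)+\mathbf{d}(z,y)$ for all $x,y,z\in X$ (neither symmetry nor $\mathbf{d}(x,x)=0$ is required). In $[0,\infty]$, $\inf\emptyset=\infty$ and $\sup\emptyset=0$. $\mathbf{e}^{\mathrm{op}}(x,y)=\mathbf{e}(y,x)$. A net is a family $(x_\lambda)_{\lambda\in\Lambda}$ indexed by a nonempty set $\Lambda$ with a transitive (possibly non-reflexive) relation $\prec$ such that for all $\gamma,\delta\in\Lambda$ there is $\lambda$ with $\gamma,\delta\prec\lambda$. Limits are taken with "eventually" meaning "for all $\lambda\succ\alpha$, for some $\alpha$". The net is $\mathbf{d}$-Cauchy if for every $\epsilon>0$ there is $\alpha$ such that $\mathbf{d}(x_\gamma,x_\delta)<\epsilon$ whenever $\alpha\prec\gamma\prec\delta$ (similarly $\mathbf{e}$-Cauchy). For a $\mathbf{d}$-Cauchy net the limits $\lim_\lambda\mathbf{d}(x_\lambda,z)$ and $\lim_\lambda\mathbf{d}(z,x_\lambda)$ exist in $[0,\infty]$ for every $z\in X$. $X$ is $\mathbf{e}$-complete if for every $\mathbf{e}$-Cauchy net $(z_\lambda)$ in $X$ there is $z\in X$ such that $\liminf_\lambda\mathbf{e}(z_\lambda,c)\geq\mathbf{e}(z,c)$ and $\liminf_\lambda\mathbf{e}(c,z_\lambda)\geq\mathbf{e}(c,z)$ for all $c\in X$. $X$ is $\mathbf{e}$-separable if there is a countable $Y\subseteq X$ with $\inf_{y\in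 Y}\mathbf{e}(x,y)=0$ for all $x\in X$. $x\leq^{\mathbf{d}}y$ iff $\mathbf{d}(x,y)=0$. $Y\subseteq X$ is $\mathbf{d}$-directed if for every finite $F\subseteq Y$, $\inf_{y\in Y}\sup_{z\in F}\mathbf{d}(z,y)=0$; $Y$ is $\leq^{\mathbf{d}}$-directed if for every finite $F\subseteq Y$ there is $y\in Y$ with $z\leq^{\mathbf{d}}y$ for all $z\in F$. Functions on $X\times X$: $$(\mathbf{e}\circ\Phi^{\mathbf{d}})(x,y)=\sup_{\epsilon>0}\ \inf\{\mathbf{e}(x,z):z\in X,\ \mathbf{d}(z,y)<\epsilon\},\qquad(\mathbf{e}\circ{\leq^{\mathbf{d}}})(x,y)=\inf\{\mathbf{e}(x,z):z\in X,\ z\leq^{\mathbf{d}}y\}.$$ For $[0,\infty]$-valued functions $f,g$ on a common set $S$ (here $S=X\times X$), $f\precapprox g$ means $\sup\{f(s):s\in S,\ g(s)\leq r\}\to0$ as $r\to0$. *)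

theory Defs
  imports "HOL-Analysis.Analysis"
begin

definition distance_on :: "'a set \<Rightarrow> ('a \<Rightarrow> 'a \<Rightarrow> ennreal) \<Rightarrow> bool" where
  "distance_on X d \<longleftrightarrow> (\<forall>x\<in>X. \<forall>y\<in>X. \<forall>z\<in>X. d x y \<le> d x z + d z y)"

definition net_index :: "'i set \<Rightarrow> ('i \<Rightarrow> 'i \<Rightarrow> bool) \<Rightarrow> bool" where
  "net_index \<Lambda> r \<longleftrightarrow> \<Lambda> \<noteq> {} \<and> transp_on \<Lambda> r \<and>
     (\<forall>\<gamma>\<in>\<Lambda>. \<forall>\<delta>\<in>\<Lambda>. \<exists>l\<in>\<Lambda>. r \<gamma> l \<and> r \<delta> l)"

definition net_filter :: "'i set \<Rightarrow> ('i \<Rightarrow> 'i \<Rightarrow> bool) \<Rightarrow> 'i filter" where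
  "net_filter \<Lambda> r = (INF \<alpha>\<in>\<Lambda>. principal {l\<in>\<Lambda>. r \<alpha> l})"

lemma eventually_net_filter:
  assumes "net_index \<Lambda> r"
  shows "eventually P (net_filter \<Lambda> r) \<longleftrightarrow> (\<exists>\<alpha>\<in>\<Lambda>. \<forall>l\<in>\<Lambda>. r \<alpha> l \<longrightarrow> P l)"
proof -
  have "eventually P (net_filter \<Lambda> r) \<longleftrightarrow>
      (\<exists>\<alpha>\<in>\<Lambda>. eventually P (principal {l\<in>\<Lambda>. r \<alpha> l}))"
    unfolding net_filter_def
  proof (rule eventually_INF_base)
    show "\<Lambda> \<noteq> {}" using assms by (simp add: net_index_def)
  next
    fix a b assume ab: "a \<in> \<Lambda>" "b \<in> \<Lambda>"
    then obtain l where l: "l \<in> \<Lambda>" "r a l" "r b l"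
      using assms unfolding net_index_def by blast
    have "{m\<in>\<Lambda>. r l m} \<subseteq> {m\<in>\<Lambda>. r a m} \<inter> {m\<in>\<Lambda>. r b m}"
      using assms l ab unfolding net_index_def transp_on_def by blast
    then show "\<exists>x\<in>\<Lambda>. principal {m\<in>\<Lambda>. r x m} \<le>
        inf (principal {m\<in>\<Lambda>. r a m}) (principal {m\<in>\<Lambda>. r b m})"
      using l(1) by auto
  qed
  then show ?thesis by (auto simp: eventually_principal)
qed

lemma net_filter_neq_bot:
  assumes "net_index \<Lambda> r"
  shows "net_filter \<Lambda> r \<noteq> bot"
  using assms unfolding trivial_limit_def eventually_net_filter[OF assms]
  by (auto simp: net_index_def)

definition cauchy_net ::
  "('a \<Rightarrow> 'a \<Rightarrow> ennreal) \<Rightarrow> 'i set \<Rightarrow> ('i \<Rightarrow> 'i \<Rightarrow> bool) \<Rightarrow> ('i \<Rightarrow> 'a) \<Rightarrow> bool" where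
  "cauchy_net d \<Lambda> r x \<longleftrightarrow>
     (\<forall>\<epsilon>>0. \<exists>\<alpha>\<in>\<Lambda>. \<forall>\<gamma>\<in>\<Lambda>. \<forall>\<delta>\<in>\<Lambda>. r \<alpha> \<gamma> \<longrightarrow> r \<gamma> \<delta> \<longrightarrow> d (x \<gamma>) (x \<delta>) < \<epsilon>)"

definition completing_point ::
  "'a set \<Rightarrow> ('a \<Rightarrow> 'a \<Rightarrow> ennreal) \<Rightarrow> 'i set \<Rightarrow> ('i \<Rightarrow> 'i \<Rightarrow> bool) \<Rightarrow> ('i \<Rightarrow> 'a) \<Rightarrow> 'a \<Rightarrow> bool" where
  "completing_point X e \<Lambda> r z p \<longleftrightarrow>
     (\<forall>c\<in>X. Liminf (net_filter \<Lambda> r) (\<lambda>l. e (z l) c) \<ge> e p c \<and>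
            Liminf (net_filter \<Lambda> r) (\<lambda>l. e c (z l)) \<ge> e c p)"

text \<open>Completeness concerns nets over arbitrary index sets, but a definition cannot
  quantify over types. The index type \<open>('a \<times> nat) set\<close> used here loses nothing:
  by \<open>complete_on_any_index\<close> below, nets over every other index type are covered.\<close>

definition complete_on :: "'a set \<Rightarrow> ('a \<Rightarrow> 'a \<Rightarrow> ennreal) \<Rightarrow> bool" where
  "complete_on X e \<longleftrightarrow>
     (\<forall>(\<Lambda> :: ('a \<times> nat) set set) r z.
        net_index \<Lambda> r \<longrightarrow> z \<in> \<Lambda> \<rightarrow> X \<longrightarrow> cauchy_net e \<Lambda> r z \<longrightarrow>
        (\<exists>p\<in>X. completing_point X e \<Lambda> r z p))"

lemma net_index_finite_bound:
  assumes "net_index \<Lambda> r" "finite A" "A \<subseteq> \<Lambda>"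
  shows "\<exists>l\<in>\<Lambda>. \<forall>a\<in>A. r a l"
  using assms(2,3)
proof (induction A rule: finite_induct)
  case empty
  then show ?case using assms(1) by (auto simp: net_index_def)
next
  case (insert b A)
  then obtain l where l: "l \<in> \<Lambda>" "\<forall>a\<in>A. r a l" by auto
  obtain m where m: "m \<in> \<Lambda>" "r b m" "r l m"
    using assms(1) insert.prems l(1) unfolding net_index_def by (meson insert_subset)
  have "r a m" if "a \<in> A" for a
    using assms(1) insert.prems l m that unfolding net_index_def transp_on_def
    by (meson insert_subset subsetD)
  then show ?case using m by auto
qed

lemma complete_on_any_index:
  fixes \<Lambda> :: "'i set" and X :: "'a set"
  assumes dist: "distance_on X e" and compl: "complete_on X e"
    and net: "net_index \<Lambda> r" and zX: "z \<in> \<Lambda> \<rightarrow> X" and cau: "cauchy_net e \<Lambda> r z"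
  shows "\<exists>p\<in>X. completing_point X e \<Lambda> r z p"
proof -
  let ?F = "net_filter \<Lambda> r"
  define h where "h n = ennreal (1 / real (Suc n))" for n
  have h0: "h n > 0" for n by (simp add: h_def)
  have h_small: "\<exists>n. h n < \<epsilon>" if "\<epsilon> > 0" for \<epsilon>
  proof -
    obtain y where y: "0 < y" "y < \<epsilon>" using dense[OF \<open>\<epsilon> > 0\<close>] by blast
    then obtain q where yq: "y = ennreal q" by (cases y) auto
    with y have q: "0 < ennreal q" "ennreal q < \<epsilon>" by auto
    then have "0 < q" by (simp add: ennreal_less_zero_iff)
    then obtain n where "1 / real (Suc n) < q"
      using reals_Archimedean[of q] by (auto simp: inverse_eq_divide)
    then have "h n < ennreal q" unfolding h_def by (intro ennreal_lessI) (use q in auto)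
    then show ?thesis using q by (meson order.strict_trans)
  qed
  have tr: "r a c" if "r a b" "r b c" "a \<in> \<Lambda>" "b \<in> \<Lambda>" "c \<in> \<Lambda>" for a b c
    using net that unfolding net_index_def transp_on_def by blast
  have "\<forall>n. \<exists>\<alpha>\<in>\<Lambda>. \<forall>\<gamma>\<in>\<Lambda>. \<forall>\<delta>\<in>\<Lambda>. r \<alpha> \<gamma> \<longrightarrow> r \<gamma> \<delta> \<longrightarrow> e (z \<gamma>) (z \<delta>) < h n"
    using cau h0 unfolding cauchy_net_def by blast
  then obtain a where a: "\<And>n. a n \<in> \<Lambda>"
    "\<And>n \<gamma> \<delta>. \<gamma> \<in> \<Lambda> \<Longrightarrow> \<delta> \<in> \<Lambda> \<Longrightarrow> r (a n) \<gamma> \<Longrightarrow> r \<gamma> \<delta> \<Longrightarrow> e (z \<gamma>) (z \<delta>) < h n"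
    by metis
  define L where "L c = Liminf ?F (\<lambda>l. e c (z l))" for c
  have "\<exists>b\<in>\<Lambda>. r (a n) b \<and> e c (z b) \<le> L c + h n" for c n
  proof (rule ccontr)
    assume neg: "\<not> ?thesis"
    then have big: "e c (z b) > L c + h n" if "b \<in> \<Lambda>" "r (a n) b" for b
      using that by (meson not_le)
    have "eventually (\<lambda>b. L c + h n \<le> e c (z b)) ?F"
      unfolding eventually_net_filter[OF net] using big a(1) by (meson less_imp_le)
    then have le: "L c + h n \<le> L c" unfolding L_def by (rule Liminf_bounded)
    have "L c \<noteq> top"
    proof
      assume "L c = top"
      obtain b where "b \<in> \<Lambda>" "r (a n) b"
        using net a(1) unfolding net_index_def by blast
      then have "L c + h n < e c (z b)" by (rule big)
      then show False using \<open>L c = top\<close> by simp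
    qed
    then have "L c + 0 < L c + h n"
      using h0[of n] by (simp only: ennreal_add_left_cancel_less) simp
    then show False using le by simp
  qed
  then have "\<forall>p. \<exists>b. b \<in> \<Lambda> \<and> r (a (snd p)) b \<and> e (fst p) (z b) \<le> L (fst p) + h (snd p)"
    by blast
  then obtain b where b: "\<And>p. b p \<in> \<Lambda>" "\<And>p. r (a (snd p)) (b p)"
      "\<And>p. e (fst p) (z (b p)) \<le> L (fst p) + h (snd p)"
    by metis
  define P where "P g F m \<longleftrightarrow> (finite F \<longrightarrow>
      m \<in> \<Lambda> \<and> (\<forall>p\<in>F. r (b p) m) \<and> (\<forall>G. G \<subset> F \<longrightarrow> r (g G) m))"
    for g and F :: "('a \<times> nat) set" and m
  have "\<exists>g. \<forall>F. P g F (g F)"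
  proof (rule dependent_wf_choice[OF wf_finite_psubset])
    fix f g :: "('a \<times> nat) set \<Rightarrow> 'i" and F m
    assume "\<And>G. (G, F) \<in> finite_psubset \<Longrightarrow> f G = g G"
    then show "P f F m = P g F m"
      unfolding P_def finite_psubset_def by auto
  next
    fix F :: "('a \<times> nat) set" and g
    assume IH: "\<And>G. (G, F) \<in> finite_psubset \<Longrightarrow> P g G (g G)"
    show "\<exists>m. P g F m"
    proof (cases "finite F")
      case True
      have "finite (b ` F \<union> g ` {G. G \<subset> F})"
      proof -
        have "{G. G \<subset> F} \<subseteq> Pow F" by auto
        then have "finite {G. G \<subset> F}" using True by (meson finite_Pow_iff finite_subset)
        then show ?thesis using True by simp
      qed
      moreover have "b ` F \<union> g ` {G. G \<subset> F} \<subseteq> \<Lambda>"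
      proof -
        have "g G \<in> \<Lambda>" if "G \<subset> F" for G
        proof -
          have "finite G" using that True finite_subset by (meson psubset_imp_subset)
          then show ?thesis using IH[of G] that True by (simp add: P_def finite_psubset_def)
        qed
        then show ?thesis using b(1) by auto
      qed
      ultimately obtain m where "m \<in> \<Lambda>" "\<forall>k \<in> b ` F \<union> g ` {G. G \<subset> F}. r k m"
        using net_index_finite_bound[OF net] by meson
      then have "P g F m" by (simp add: P_def)
      then show ?thesis ..
    qed (simp add: P_def)
  qed
  then obtain g where g: "\<And>F. P g F (g F)" by blast
  define I where "I = {F :: ('a \<times> nat) set. finite F}"
  have gL: "g F \<in> \<Lambda>" if "F \<in> I" for F using g[of F] that by (simp add: P_def I_def)
  have gb: "r (b p) (g F)" if "F \<in> I" "p \<in> F" for F p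
    using g[of F] that by (simp add: P_def I_def)
  have gg: "r (g G) (g F)" if "F \<in> I" "G \<subset> F" for F G
    using g[of F] that by (simp add: P_def I_def)
  have ga: "r (a (snd p)) (g F)" if "F \<in> I" "p \<in> F" for F p
    using tr[OF b(2) gb[OF that] a(1) b(1) gL[OF that(1)]] .
  have netI: "net_index I (\<subset>)"
    unfolding net_index_def
  proof (intro conjI ballI)
    show "I \<noteq> {}" by (auto simp: I_def)
    show "transp_on I (\<subset>)" by (rule transp_on_less)
    fix F G assume "F \<in> I" "G \<in> I"
    then have fin: "finite (F \<union> G)" by (simp add: I_def)
    have "infinite (UNIV :: ('a \<times> nat) set)"
      by (simp add: finite_prod)
    then obtain p where p: "p \<notin> F \<union> G" using fin ex_new_if_finite by blast
    show "\<exists>l\<in>I. F \<subset> l \<and> G \<subset> l"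
      using p fin by (intro bexI[of _ "insert p (F \<union> G)"]) (auto simp: I_def)
  qed
  have "cauchy_net e I (\<subset>) (\<lambda>F. z (g F))"
    unfolding cauchy_net_def
  proof (intro allI impI)
    fix \<epsilon> :: ennreal assume "\<epsilon> > 0"
    then obtain n where n: "h n < \<epsilon>" using h_small by blast
    have "e (z (g F)) (z (g G)) < \<epsilon>"
      if "F \<in> I" "G \<in> I" "{(undefined, n)} \<subset> F" "F \<subset> G" for F G
    proof -
      have "r (a n) (g F)" using ga[of F "(undefined, n)"] that by auto
      then have "e (z (g F)) (z (g G)) < h n"
        using a(2) gL gg that by simp
      then show ?thesis using n by (rule order.strict_trans)
    qed
    then show "\<exists>\<alpha>\<in>I. \<forall>\<gamma>\<in>I. \<forall>\<delta>\<in>I. \<alpha> \<subset> \<gamma> \<longrightarrow> \<gamma> \<subset> \<delta> \<longrightarrow> e (z (g \<gamma>)) (z (g \<delta>)) < \<epsilon>"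
      by (intro bexI[of _ "{(undefined, n)}"]) (auto simp: I_def)
  qed
  moreover have "(\<lambda>F. z (g F)) \<in> I \<rightarrow> X" using zX gL by auto
  ultimately obtain p where p: "p \<in> X" "completing_point X e I (\<subset>) (\<lambda>F. z (g F)) p"
    using compl netI unfolding complete_on_def by blast
  let ?G = "net_filter I (\<subset>)"
  have Gbot: "?G \<noteq> bot" using net_filter_neq_bot[OF netI] .
  have evI: "eventually Q ?G" if "\<And>F. F \<in> I \<Longrightarrow> q \<in> F \<Longrightarrow> Q F" for Q q
    unfolding eventually_net_filter[OF netI]
    using that by (intro bexI[of _ "{q}"]) (auto simp: I_def)
  have tri: "e x y \<le> e x w + e w y" if "x \<in> X" "y \<in> X" "w \<in> X" for x y w
    using dist that unfolding distance_on_def by blast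
  have "completing_point X e \<Lambda> r z p"
    unfolding completing_point_def
  proof (intro ballI conjI)
    fix c assume c: "c \<in> X"
    let ?M = "Liminf ?F (\<lambda>l. e (z l) c)"
    have "e p c \<le> ?M + h n" for n
    proof -
      have bd: "e (z \<gamma>) c \<le> ?M + h n" if "\<gamma> \<in> \<Lambda>" "r (a n) \<gamma>" for \<gamma>
      proof -
        have "e (z \<gamma>) c - h n \<le> e (z \<delta>) c" if "\<delta> \<in> \<Lambda>" "r \<gamma> \<delta>" for \<delta>
        proof -
          have "e (z \<gamma>) c \<le> e (z \<gamma>) (z \<delta>) + e (z \<delta>) c"
            using tri zX c \<open>\<gamma> \<in> \<Lambda>\<close> that by auto
          also have "\<dots> \<le> h n + e (z \<delta>) c"
            using a(2)[of \<gamma> \<delta> n] that \<open>\<gamma> \<in> \<Lambda>\<close> \<open>r (a n) \<gamma>\<close> by (intro add_right_mono) auto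
          finally show ?thesis by (auto simp: ennreal_minus_le_iff h_def)
        qed
        then have "eventually (\<lambda>\<delta>. e (z \<gamma>) c - h n \<le> e (z \<delta>) c) ?F"
          unfolding eventually_net_filter[OF net] using that by blast
        then have "e (z \<gamma>) c - h n \<le> ?M" by (rule Liminf_bounded)
        then show ?thesis by (auto simp: ennreal_minus_le_iff h_def add.commute)
      qed
      have "e p c \<le> Liminf ?G (\<lambda>F. e (z (g F)) c)"
        using p(2) c unfolding completing_point_def by blast
      also have "\<dots> \<le> ?M + h n"
        by (rule Liminf_le[OF Gbot], rule evI[of "(undefined, n)"])
          (use bd gL ga in force)
      finally show ?thesis .
    qed note * = this
    show "e p c \<le> ?M"
    proof (rule ennreal_le_epsilon)
      fix \<epsilon> :: real assume "0 < \<epsilon>"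
      then obtain n where "h n < ennreal \<epsilon>" using h_small[of "ennreal \<epsilon>"] by auto
      then show "e p c \<le> ?M + ennreal \<epsilon>" using *[of n]
        by (meson add_left_mono less_imp_le order.trans)
    qed
  next
    fix c assume c: "c \<in> X"
    have *: "e c p \<le> L c + h n + h n" for n
    proof -
      have "e c p \<le> Liminf ?G (\<lambda>F. e c (z (g F)))"
        using p(2) c unfolding completing_point_def by blast
      also have "\<dots> \<le> L c + h n + h n"
      proof (rule Liminf_le[OF Gbot], rule evI[of "(c, n)"])
        fix F assume F: "F \<in> I" "(c, n) \<in> F"
        let ?b = "b (c, n)"
        have "e c (z (g F)) \<le> e c (z ?b) + e (z ?b) (z (g F))"
          using c funcset_mem[OF zX b(1)] funcset_mem[OF zX gL[OF F(1)]] by (intro tri)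
        also have "\<dots> \<le> (L c + h n) + h n"
          using a(2)[OF b(1) gL[OF F(1)], of n "(c, n)"] b(2)[of "(c, n)"] b(3)[of "(c, n)"] gb[OF F]
          by (intro add_mono) auto
        finally show "e c (z (g F)) \<le> L c + h n + h n" .
      qed
      finally show ?thesis .
    qed
    show "e c p \<le> Liminf ?F (\<lambda>l. e c (z l))"
      unfolding L_def[symmetric]
    proof (rule ennreal_le_epsilon)
      fix \<epsilon> :: real assume "0 < \<epsilon>"
      then obtain n where "h n < ennreal (\<epsilon> / 2)" using h_small[of "ennreal (\<epsilon> / 2)"] by auto
      then have "h n + h n \<le> ennreal (\<epsilon> / 2) + ennreal (\<epsilon> / 2)" by (intro add_mono) auto
      also have "\<dots> = ennreal \<epsilon>" using \<open>0 < \<epsilon>\<close> by (simp flip: ennreal_plus)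
      finally show "e c p \<le> L c + ennreal \<epsilon>" using *[of n]
        by (metis add.assoc add_left_mono order.trans)
    qed
  qed
  then show ?thesis using p(1) by blast
qed

definition separable_on :: "'a set \<Rightarrow> ('a \<Rightarrow> 'a \<Rightarrow> ennreal) \<Rightarrow> bool" where
  "separable_on X e \<longleftrightarrow> (\<exists>Y\<subseteq>X. countable Y \<and> (\<forall>x\<in>X. (INF y\<in>Y. e x y) = 0))"

definition leqd :: "('a \<Rightarrow> 'a \<Rightarrow> ennreal) \<Rightarrow> 'a \<Rightarrow> 'a \<Rightarrow> bool" where
  "leqd d x y \<longleftrightarrow> d x y = 0"

text \<open>In \<^typ>\<open>ennreal\<close>, the infimum over \<open>{}\<close> is \<open>\<infinity>\<close> and the supremum is \<open>0\<close>; hence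
  \<open>F = {}\<close> in the next two definitions forces \<open>Y\<close> to be nonempty.\<close>

definition d_directed :: "('a \<Rightarrow> 'a \<Rightarrow> ennreal) \<Rightarrow> 'a set \<Rightarrow> bool" where
  "d_directed d Y \<longleftrightarrow> (\<forall>F\<subseteq>Y. finite F \<longrightarrow> (INF y\<in>Y. SUP z\<in>F. d z y) = 0)"

definition leqd_directed :: "('a \<Rightarrow> 'a \<Rightarrow> ennreal) \<Rightarrow> 'a set \<Rightarrow> bool" where
  "leqd_directed d Y \<longleftrightarrow> (\<forall>F\<subseteq>Y. finite F \<longrightarrow> (\<exists>y\<in>Y. \<forall>z\<in>F. leqd d z y))"

definition comp_Phi ::
  "'a set \<Rightarrow> ('a \<Rightarrow> 'a \<Rightarrow> ennreal) \<Rightarrow> ('a \<Rightarrow> 'a \<Rightarrow> ennreal) \<Rightarrow> 'a \<Rightarrow> 'a \<Rightarrow> ennreal" where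
  "comp_Phi X e d x y = (SUP \<epsilon>\<in>{0<..}. INF z\<in>{z\<in>X. d z y < \<epsilon>}. e x z)"

definition comp_leqd ::
  "'a set \<Rightarrow> ('a \<Rightarrow> 'a \<Rightarrow> ennreal) \<Rightarrow> ('a \<Rightarrow> 'a \<Rightarrow> ennreal) \<Rightarrow> 'a \<Rightarrow> 'a \<Rightarrow> ennreal" where
  "comp_leqd X e d x y = (INF z\<in>{z\<in>X. leqd d z y}. e x z)"

definition precapprox_on :: "'s set \<Rightarrow> ('s \<Rightarrow> ennreal) \<Rightarrow> ('s \<Rightarrow> ennreal) \<Rightarrow> bool" where
  "precapprox_on S f g \<longleftrightarrow> ((\<lambda>r. SUP s\<in>{s\<in>S. g s \<le> r}. f s) \<longlongrightarrow> 0) (at_right 0)"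

definition same_net_limits ::
  "'a set \<Rightarrow> ('a \<Rightarrow> 'a \<Rightarrow> ennreal) \<Rightarrow> 'i set \<Rightarrow> ('i \<Rightarrow> 'i \<Rightarrow> bool) \<Rightarrow> ('i \<Rightarrow> 'a) \<Rightarrow> 'a set \<Rightarrow> bool" where
  "same_net_limits X d \<Lambda> r x Y \<longleftrightarrow>
     (\<forall>z\<in>X. ((\<lambda>l. d (x l) z) \<longlongrightarrow> (SUP y\<in>Y. d y z)) (net_filter \<Lambda> r) \<and>
            ((\<lambda>l. d z (x l)) \<longlongrightarrow> (INF y\<in>Y. d z y)) (net_filter \<Lambda> r))"

end

theory Submission
  imports Defs
begin

text \<open>The hypothesis \<open>e \<circ> \<Phi>\<^sup>d \<lessapprox> d\<close> says that if \<open>d a y\<close> is small then \<open>a\<close> can be moved, by little in the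
  sense of \<open>e\<close>, to a point \<open>b\<close> with \<open>d b y\<close> as small as desired. Iterating and passing to the
  limit (\<open>e\<close> is complete, and \<open>d\<close> is uniformly controlled by \<open>e\<close>) makes \<open>d b y\<close> vanish.
  The same argument works with \<open>d _ y\<close> replaced by \<open>a \<mapsto> lim\<^sub>\<lambda> d a x\<^sub>\<lambda>\<close>, so the zero set \<open>Y\<close> of this function
  comes \<open>e\<close>-arbitrarily close to the tails of the net, which gives the first set \<open>Y\<close>.

  In the separable case take a sequence \<open>w\<close> that is \<open>e\<close>-dense in \<open>Y\<close>, and build finite chains
  \<open>C m 0 \<le>\<^sup>d \<dots> \<le>\<^sup>d C m m\<close> with \<open>C m m \<in> Y\<close>. The chain \<open>C (m + 1)\<close> is found by choosing its top in \<open>Y\<close>, nearly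
  above \<open>C m m\<close> and \<open>w 0, \<dots>, w m\<close>, and then correcting the old chain downwards from that top by less
  than \<open>2\<^sup>-\<^sup>m\<close>. The columns of this array converge to an increasing sequence in \<open>Y\<close> that is
  \<open>d\<close>-cofinal in \<open>Y\<close>.\<close>

section \<open>Dyadic tolerances and additive slack in \<open>ennreal\<close>\<close>

definition dyadic :: "nat \<Rightarrow> ennreal" where
  "dyadic n = ennreal ((1/2) ^ n)"

lemma dyadic_pos: "0 < dyadic n"
  by (simp add: dyadic_def)

lemma dyadic_Suc: "dyadic (Suc n) + dyadic (Suc n) = dyadic n"
  unfolding dyadic_def by (simp flip: ennreal_plus)

lemma dyadic_tendsto: "dyadic \<longlonglongrightarrow> 0"
proof -
  have "(\<lambda>n. ennreal ((1/2) ^ n)) \<longlonglongrightarrow> ennreal 0"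
    by (intro tendsto_ennrealI LIMSEQ_realpow_zero) auto
  then show ?thesis by (simp add: dyadic_def[abs_def])
qed

lemma dyadic_less: "0 < \<epsilon> \<Longrightarrow> \<exists>n. dyadic n < \<epsilon>"
  using order_tendstoD(2)[OF dyadic_tendsto] by (meson eventually_sequentially order_refl)

text \<open>A point strictly between \<open>a\<close> and \<open>b\<close> is finite, so its
  difference from \<open>a\<close> can be taken safely even when \<open>b\<close> is
  \<open>top\<close>.\<close>

lemma ennreal_add_gap:
  fixes a b :: ennreal
  assumes "a < b"
  shows "\<exists>\<epsilon>>0. a + \<epsilon> < b"
proof -
  obtain c where c: "a < c" "c < b" using dense[OF assms] by blast
  then have "a + (c - a) = c" "c - a > 0" by (auto simp: diff_gr0_ennreal)
  then show ?thesis using c by metis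
qed

lemma ennreal_half_gap:
  fixes \<epsilon> :: ennreal
  assumes "0 < \<epsilon>"
  shows "\<exists>\<delta>>0. \<delta> + \<delta> < \<epsilon>"
proof -
  obtain n where "dyadic n < \<epsilon>" using dyadic_less[OF assms] by blast
  then show ?thesis using dyadic_Suc[of n] dyadic_pos[of "Suc n"] by metis
qed

lemma ennreal_zero_if_le_all:
  fixes a :: ennreal
  assumes "\<And>\<epsilon>. 0 < \<epsilon> \<Longrightarrow> a \<le> \<epsilon>"
  shows "a = 0"
  by (metis assms dense leD not_gr_zero)

section \<open>Epsilon forms of uniform control and of the required limits\<close>

lemma precapprox_onD:
  assumes "precapprox_on S f g" "0 < \<epsilon>"
  shows "\<exists>\<delta>>0. \<forall>s\<in>S. g s < \<delta> \<longrightarrow> f s < \<epsilon>"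
proof -
  have "eventually (\<lambda>r. (SUP s\<in>{s\<in>S. g s \<le> r}. f s) < \<epsilon>) (at_right 0)"
    using assms order_tendstoD(2) unfolding precapprox_on_def by blast
  then obtain b where b: "0 < b" "\<And>r. 0 < r \<Longrightarrow> r < b \<Longrightarrow> (SUP s\<in>{s\<in>S. g s \<le> r}. f s) < \<epsilon>"
    unfolding eventually_at_right[of 0 "1::ennreal", simplified] by auto
  obtain r where r: "0 < r" "r < b" using dense[OF b(1)] by blast
  have "f s < \<epsilon>" if "s \<in> S" "g s < r" for s
    using that by (intro le_less_trans[OF SUP_upper b(2)[OF r]]) auto
  then show ?thesis using r by blast
qed

lemma net_index_nat: "net_index (UNIV :: nat set) (<)"
  unfolding net_index_def by (auto intro: transp_on_less) (metis less_Suc_eq_le max.cobounded1 max.cobounded2)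

text \<open>Each of the four one-sided estimates is a single triangle inequality through some
  \<open>y\<close> and a late \<open>x l\<close>. In \<open>below\<close> the stage may depend on
  \<open>y\<close>; in \<open>above\<close> the point \<open>y\<close> may depend on
  \<open>l\<close>.\<close>

lemma same_net_limitsI:
  assumes dist: "distance_on X d" and net: "net_index \<Lambda> r" and xX: "x \<in> \<Lambda> \<rightarrow> X" and YX: "Y \<subseteq> X"
    and below: "\<And>y \<epsilon>. y \<in> Y \<Longrightarrow> 0 < \<epsilon> \<Longrightarrow> eventually (\<lambda>l. d y (x l) < \<epsilon>) (net_filter \<Lambda> r)"
    and above: "\<And>\<epsilon>. 0 < \<epsilon> \<Longrightarrow> eventually (\<lambda>l. \<exists>y\<in>Y. d (x l) y < \<epsilon>) (net_filter \<Lambda> r)"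
  shows "same_net_limits X d \<Lambda> r x Y"
proof -
  let ?F = "net_filter \<Lambda> r"
  have tri: "d a b \<le> d a c + d c b" if "a \<in> X" "b \<in> X" "c \<in> X" for a b c
    using dist that unfolding distance_on_def by blast
  have inX: "eventually (\<lambda>l. x l \<in> X) ?F"
    unfolding eventually_net_filter[OF net] using net xX by (auto simp: net_index_def)
  have "((\<lambda>l. d (x l) z) \<longlongrightarrow> (SUP y\<in>Y. d y z)) ?F" if z: "z \<in> X" for z
  proof (rule order_tendstoI)
    fix a assume "a < (SUP y\<in>Y. d y z)"
    then obtain y where y: "y \<in> Y" "a < d y z" by (auto simp: less_SUP_iff)
    then obtain \<epsilon> where \<epsilon>: "0 < \<epsilon>" "a + \<epsilon> < d y z" using ennreal_add_gap by blast
    show "eventually (\<lambda>l. a < d (x l) z) ?F"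
      using inX below[OF y(1) \<epsilon>(1)]
    proof eventually_elim
      case (elim l)
      show ?case
      proof (rule ccontr)
        assume "\<not> a < d (x l) z"
        then have "d y (x l) + d (x l) z \<le> \<epsilon> + a" using elim by (intro add_mono) auto
        then show False using tri[of y z "x l"] elim y YX z \<epsilon>(2) by (auto simp: add.commute)
      qed
    qed
  next
    fix a assume "(SUP y\<in>Y. d y z) < a"
    then obtain \<epsilon> where \<epsilon>: "0 < \<epsilon>" "(SUP y\<in>Y. d y z) + \<epsilon> < a" using ennreal_add_gap by blast
    show "eventually (\<lambda>l. d (x l) z < a) ?F"
      using inX above[OF \<epsilon>(1)]
    proof eventually_elim
      case (elim l)
      then obtain y where y: "y \<in> Y" "d (x l) y < \<epsilon>" by blast
      have "d (x l) z \<le> d (x l) y + d y z" using elim y YX z by (intro tri) auto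
      also have "\<dots> \<le> \<epsilon> + (SUP y\<in>Y. d y z)" using y by (intro add_mono SUP_upper) auto
      finally show ?case using \<epsilon> by (simp add: add.commute)
    qed
  qed
  moreover have "((\<lambda>l. d z (x l)) \<longlongrightarrow> (INF y\<in>Y. d z y)) ?F" if z: "z \<in> X" for z
  proof (rule order_tendstoI)
    fix a assume "(INF y\<in>Y. d z y) < a"
    then obtain y where y: "y \<in> Y" "d z y < a" by (auto simp: INF_less_iff)
    then obtain \<epsilon> where \<epsilon>: "0 < \<epsilon>" "d z y + \<epsilon> < a" using ennreal_add_gap by blast
    show "eventually (\<lambda>l. d z (x l) < a) ?F"
      using inX below[OF y(1) \<epsilon>(1)]
    proof eventually_elim
      case (elim l)
      have "d z (x l) \<le> d z y + d y (x l)" using elim y YX z by (intro tri) auto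
      also have "\<dots> \<le> d z y + \<epsilon>" using elim by (intro add_mono) auto
      finally show ?case using \<epsilon> by simp
    qed
  next
    fix a assume "a < (INF y\<in>Y. d z y)"
    then obtain \<epsilon> where \<epsilon>: "0 < \<epsilon>" "a + \<epsilon> < (INF y\<in>Y. d z y)" using ennreal_add_gap by blast
    show "eventually (\<lambda>l. a < d z (x l)) ?F"
      using inX above[OF \<epsilon>(1)]
    proof eventually_elim
      case (elim l)
      then obtain y where y: "y \<in> Y" "d (x l) y < \<epsilon>" by blast
      show ?case
      proof (rule ccontr)
        assume "\<not> a < d z (x l)"
        then have "d z (x l) + d (x l) y \<le> a + \<epsilon>" using y by (intro add_mono) auto
        moreover have "(INF y\<in>Y. d z y) \<le> d z y" using y by (intro INF_lower)
        moreover have "d z y \<le> d z (x l) + d (x l) y" using elim y YX z by (intro tri) auto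
        ultimately show False using \<epsilon>(2) by auto
      qed
    qed
  qed
  ultimately show ?thesis unfolding same_net_limits_def by blast
qed

lemma leqd_directed_imp_d_directed:
  assumes "leqd_directed d Y"
  shows "d_directed d Y"
  unfolding d_directed_def
proof (intro allI impI)
  fix F assume "F \<subseteq> Y" "finite F"
  then obtain y where y: "y \<in> Y" "\<forall>z\<in>F. leqd d z y"
    using assms unfolding leqd_directed_def by blast
  have "(INF y\<in>Y. SUP z\<in>F. d z y) \<le> (SUP z\<in>F. d z y)" using y(1) by (rule INF_lower)
  also have "\<dots> \<le> 0" using y(2) by (intro SUP_least) (simp add: leqd_def)
  finally show "(INF y\<in>Y. SUP z\<in>F. d z y) = 0" by simp
qed

section \<open>Replacing approximate \<open>d\<close>-lower bounds by exact ones\<close>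

locale complete_distance_pair =
  fixes X :: "'a set" and d e :: "'a \<Rightarrow> 'a \<Rightarrow> ennreal"
  assumes dist_d: "distance_on X d" and dist_e: "distance_on X e"
    and compl: "complete_on X e"
    and Phi_precapprox: "precapprox_on (X \<times> X) (\<lambda>(a, b). comp_Phi X e d a b) (\<lambda>(a, b). d a b)"
    and d_precapprox: "precapprox_on (X \<times> X) (\<lambda>(a, b). d a b) (\<lambda>(a, b). e a b)"
    and sym: "\<forall>a\<in>X. \<forall>b\<in>X. e a b = e b a"
begin

lemma tri_d: "a \<in> X \<Longrightarrow> c \<in> X \<Longrightarrow> b \<in> X \<Longrightarrow> d a b \<le> d a c + d c b"
  using dist_d unfolding distance_on_def by blast

lemma tri_e: "a \<in> X \<Longrightarrow> c \<in> X \<Longrightarrow> b \<in> X \<Longrightarrow> e a b \<le> e a c + e c b"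
  using dist_e unfolding distance_on_def by blast

text \<open>Symmetry of \<open>e\<close> yields both orders of the arguments of
  \<open>d\<close>.\<close>

lemma d_small:
  "0 < \<epsilon> \<Longrightarrow> \<exists>\<delta>>0. \<forall>a\<in>X. \<forall>b\<in>X. e a b < \<delta> \<longrightarrow> d a b < \<epsilon> \<and> d b a < \<epsilon>"
  using precapprox_onD[OF d_precapprox, of \<epsilon>] sym by (auto 4 3)

text \<open>The supremum in \<open>comp_Phi\<close> bounds the infimum at every scale \<eta>, so
  \<delta> does not depend on \<eta>; this is what lets the correction be iterated.\<close>

lemma Phi_small:
  assumes "0 < \<epsilon>"
  shows "\<exists>\<delta>>0. \<forall>a\<in>X. \<forall>b\<in>X. d a b < \<delta> \<longrightarrow> (\<forall>\<eta>>0. \<exists>c\<in>X. d c b < \<eta> \<and> e a c < \<epsilon>)"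
proof -
  obtain \<delta> where \<delta>: "0 < \<delta>" "\<And>a b. a \<in> X \<Longrightarrow> b \<in> X \<Longrightarrow> d a b < \<delta> \<Longrightarrow> comp_Phi X e d a b < \<epsilon>"
    using precapprox_onD[OF Phi_precapprox assms] by auto
  have "\<exists>c\<in>X. d c b < \<eta> \<and> e a c < \<epsilon>" if "a \<in> X" "b \<in> X" "d a b < \<delta>" "0 < \<eta>" for a b \<eta>
  proof -
    have "(INF z\<in>{z\<in>X. d z b < \<eta>}. e a z) \<le> comp_Phi X e d a b"
      unfolding comp_Phi_def using that(4) by (intro SUP_upper) auto
    also have "\<dots> < \<epsilon>" using \<delta>(2) that by blast
    finally show ?thesis by (auto simp: INF_less_iff)
  qed
  then show ?thesis using \<delta>(1) by blast
qed

text \<open>Geometric summation makes \<open>z\<close> an \<open>e\<close>-Cauchy sequence; the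
  offset \<open>N\<close> sets the total size of the movement.\<close>

lemma dyadic_sequence_limit:
  assumes zX: "\<And>n. z n \<in> X" and step: "\<And>n. e (z n) (z (Suc n)) \<le> dyadic (N + n)"
  shows "\<exists>p\<in>X. \<forall>n. e (z n) p \<le> dyadic (N + n) + dyadic (N + n)"
proof -
  \<comment> \<open>Peeling off the first step closes the induction: the doubled bound at
    \<open>Suc n\<close> equals \<open>dyadic (N + n)\<close>, and the first step adds the same
    amount once more.\<close>
  have bd: "e (z n) (z (Suc (n + k))) \<le> dyadic (N + n) + dyadic (N + n)" for n k
  proof (induction k arbitrary: n)
    case 0
    then show ?case using step[of n] by (simp add: add_increasing2)
  next
    case (Suc k)
    have "e (z n) (z (Suc (n + Suc k))) \<le> e (z n) (z (Suc n)) + e (z (Suc n)) (z (Suc (Suc n + k)))"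
      using tri_e zX by simp
    also have "\<dots> \<le> dyadic (N + n) + (dyadic (N + Suc n) + dyadic (N + Suc n))"
      by (intro add_mono step Suc.IH)
    finally show ?case using dyadic_Suc[of "N + n"] by simp
  qed
  then have bd: "e (z n) (z m) \<le> dyadic (N + n) + dyadic (N + n)" if "n < m" for n m
    using that less_imp_Suc_add by blast
  have "(\<lambda>n. dyadic (N + n) + dyadic (N + n)) \<longlonglongrightarrow> 0 + 0"
    using LIMSEQ_ignore_initial_segment[OF dyadic_tendsto, of N]
    by (intro tendsto_add) (auto simp: add.commute)
  then have "cauchy_net e UNIV (<) z"
    unfolding cauchy_net_def
  proof (intro allI impI)
    fix \<epsilon> :: ennreal
    assume lim: "(\<lambda>n. dyadic (N + n) + dyadic (N + n)) \<longlonglongrightarrow> 0 + 0" and "0 < \<epsilon>"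
    then obtain n0 where "\<And>n. n0 \<le> n \<Longrightarrow> dyadic (N + n) + dyadic (N + n) < \<epsilon>"
      using order_tendstoD(2)[OF lim, of \<epsilon>] by (auto simp: eventually_sequentially)
    then show "\<exists>\<alpha>\<in>UNIV. \<forall>\<gamma>\<in>UNIV. \<forall>\<delta>\<in>UNIV. \<alpha> < \<gamma> \<longrightarrow> \<gamma> < \<delta> \<longrightarrow> e (z \<gamma>) (z \<delta>) < \<epsilon>"
      by (intro bexI[of _ n0]) (auto intro: le_less_trans[OF bd])
  qed
  then obtain p where p: "p \<in> X" "completing_point X e UNIV (<) z p"
    using complete_on_any_index[OF dist_e compl net_index_nat, of z] zX by auto
  \<comment> \<open>The second inequality of \<open>completing_point\<close>, tested at
    \<open>c = z n\<close>, carries the tail bound over to \<open>p\<close>.\<close>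
  have "e (z n) p \<le> dyadic (N + n) + dyadic (N + n)" for n
  proof -
    have "e (z n) p \<le> Liminf (net_filter UNIV (<)) (\<lambda>l. e (z n) (z l))"
      using p(2) zX unfolding completing_point_def by blast
    also have "\<dots> \<le> dyadic (N + n) + dyadic (N + n)"
    proof (rule Liminf_le[OF net_filter_neq_bot[OF net_index_nat]])
      show "eventually (\<lambda>l. e (z n) (z l) \<le> dyadic (N + n) + dyadic (N + n)) (net_filter UNIV (<))"
        unfolding eventually_net_filter[OF net_index_nat] using bd by blast
    qed
    finally show ?thesis .
  qed
  then show ?thesis using p(1) by blast
qed

text \<open>The parameter \<open>t\<close> records that \<open>\<delta>\<close> can be chosen uniformly over a family of functions;
  \<open>chain_extend\<close> needs this, as its tolerance is fixed before the new top element is.\<close>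

lemma zero_near:
  fixes f :: "'t \<Rightarrow> 'a \<Rightarrow> ennreal"
  assumes lower: "\<And>t a b. t \<in> T \<Longrightarrow> a \<in> X \<Longrightarrow> b \<in> X \<Longrightarrow> f t a \<le> d a b + f t b"
    and approx: "\<And>\<epsilon>. 0 < \<epsilon> \<Longrightarrow> \<exists>\<delta>>0. \<forall>t\<in>T. \<forall>a\<in>X. f t a < \<delta> \<longrightarrow>
      (\<forall>\<eta>>0. \<exists>b\<in>X. f t b < \<eta> \<and> e a b < \<epsilon>)"
    and "0 < \<epsilon>"
  shows "\<exists>\<delta>>0. \<forall>t\<in>T. \<forall>a\<in>X. f t a < \<delta> \<longrightarrow> (\<exists>b\<in>X. f t b = 0 \<and> e a b < \<epsilon>)"
proof -
  obtain N' where N': "dyadic N' < \<epsilon>" using dyadic_less[OF \<open>0 < \<epsilon>\<close>] by blast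
  \<comment> \<open>The extra index absorbs the doubling in the limit bound: twice
    \<open>dyadic N\<close> is \<open>dyadic N'\<close>.\<close>
  define N where "N = Suc N'"
  have "\<forall>n. \<exists>\<delta>>0. \<forall>t\<in>T. \<forall>a\<in>X. f t a < \<delta> \<longrightarrow> (\<forall>\<eta>>0. \<exists>b\<in>X. f t b < \<eta> \<and> e a b < dyadic (N + n))"
    using approx dyadic_pos by blast
  then obtain \<delta> where \<delta>: "\<And>n. 0 < \<delta> n" "\<And>n t a \<eta>. t \<in> T \<Longrightarrow> a \<in> X \<Longrightarrow> f t a < \<delta> n \<Longrightarrow> 0 < \<eta> \<Longrightarrow>
      \<exists>b\<in>X. f t b < \<eta> \<and> e a b < dyadic (N + n)" by metis
  have "\<exists>b\<in>X. f t b = 0 \<and> e a b < \<epsilon>" if t: "t \<in> T" and a: "a \<in> X" "f t a < \<delta> 0" for t a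
  proof -
    \<comment> \<open>The bound by \<open>\<delta> n\<close> permits the next correction; the bound
      by \<open>dyadic n\<close> drives \<open>f t\<close> to zero. The latter is omitted at
      \<open>n = 0\<close>, where only \<open>f t a < \<delta> 0\<close> is known.\<close>
    define P where "P n b \<longleftrightarrow> b \<in> X \<and> f t b < \<delta> n \<and> (n = 0 \<longrightarrow> b = a) \<and> (n \<noteq> 0 \<longrightarrow> f t b < dyadic n)" for n b
    have "\<exists>z. \<forall>n. P n (z n) \<and> e (z n) (z (Suc n)) < dyadic (N + n)"
    proof (rule dependent_nat_choice)
      show "\<exists>b. P 0 b" using a by (auto simp: P_def)
    next
      fix b n assume "P n b"
      then obtain c where "c \<in> X" "f t c < min (\<delta> (Suc n)) (dyadic (Suc n))" "e b c < dyadic (N + n)"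
        using \<delta>(2)[OF t, of b n "min (\<delta> (Suc n)) (dyadic (Suc n))"] \<delta>(1)[of "Suc n"] dyadic_pos[of "Suc n"]
        unfolding P_def by (metis min_less_iff_conj)
      then show "\<exists>c. P (Suc n) c \<and> e b c < dyadic (N + n)" by (auto simp: P_def)
    qed
    then obtain z where z: "\<And>n. P n (z n)" "\<And>n. e (z n) (z (Suc n)) < dyadic (N + n)" by blast
    have zX: "z n \<in> X" and zf: "f t (z (Suc n)) < dyadic (Suc n)" and z0: "z 0 = a" for n
      using z(1)[of n] z(1)[of "Suc n"] z(1)[of 0] by (auto simp: P_def)
    obtain p where p: "p \<in> X" "\<And>n. e (z n) p \<le> dyadic (N + n) + dyadic (N + n)"
      using dyadic_sequence_limit[of z N] zX z(2) by (meson less_imp_le)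
    \<comment> \<open>Applying \<open>lower\<close> with \<open>p\<close> on the left requires
      \<open>d p (z (Suc n))\<close> to be small, which is the reversed half of
      \<open>d_small\<close>.\<close>
    have "f t p \<le> \<epsilon>'" if \<epsilon>': "0 < \<epsilon>'" for \<epsilon>'
    proof -
      obtain \<eta> where \<eta>: "0 < \<eta>" "\<eta> + \<eta> < \<epsilon>'" using ennreal_half_gap[OF \<epsilon>'] by blast
      obtain \<kappa> where \<kappa>: "0 < \<kappa>" "\<And>a b. a \<in> X \<Longrightarrow> b \<in> X \<Longrightarrow> e a b < \<kappa> \<Longrightarrow> d b a < \<eta>"
        using d_small[OF \<eta>(1)] by blast
      have "eventually (\<lambda>n. dyadic n < min \<kappa> \<eta>) sequentially"
        using order_tendstoD(2)[OF dyadic_tendsto, of "min \<kappa> \<eta>"] \<kappa>(1) \<eta>(1) by simp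
      then obtain n where n: "\<And>m. n \<le> m \<Longrightarrow> dyadic m < min \<kappa> \<eta>"
        by (auto simp: eventually_sequentially)
      have "e (z (Suc n)) p \<le> dyadic (N + n)"
        using p(2)[of "Suc n"] dyadic_Suc[of "N + n"] by simp
      then have "d p (z (Suc n)) < \<eta>"
        using \<kappa>(2)[OF zX p(1)] n[of "N + n"] by auto
      moreover have "f t (z (Suc n)) < \<eta>" using zf[of n] n[of "Suc n"] by auto
      ultimately have "d p (z (Suc n)) + f t (z (Suc n)) \<le> \<eta> + \<eta>" by (intro add_mono) auto
      then show ?thesis using lower[OF t p(1) zX, of "Suc n"] \<eta>(2) by auto
    qed
    then have "f t p = 0" by (rule ennreal_zero_if_le_all)
    moreover have "e a p < \<epsilon>"
      using p(2)[of 0] N' dyadic_Suc[of N'] by (simp add: z0 N_def)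
    ultimately show ?thesis using p(1) by blast
  qed
  then show ?thesis using \<delta>(1) by blast
qed

lemma leqd_near:
  assumes "0 < \<epsilon>"
  shows "\<exists>\<delta>>0. \<forall>y\<in>X. \<forall>a\<in>X. d a y < \<delta> \<longrightarrow> (\<exists>b\<in>X. d b y = 0 \<and> e a b < \<epsilon>)"
proof (rule zero_near[where f = "\<lambda>y a. d a y"])
  show "d a y \<le> d a b + d b y" if "y \<in> X" "a \<in> X" "b \<in> X" for y a b using that tri_d by blast
  show "\<exists>\<delta>>0. \<forall>y\<in>X. \<forall>a\<in>X. d a y < \<delta> \<longrightarrow> (\<forall>\<eta>>0. \<exists>b\<in>X. d b y < \<eta> \<and> e a b < \<epsilon>)"
    if "0 < \<epsilon>" for \<epsilon> using Phi_small[OF that] by blast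
qed (rule assms)

text \<open>Exact lower bounds of \<open>y\<close> compete in every approximate infimum, which gives
  one inequality. For the other, a nearly optimal approximate lower bound is moved to an exact one
  at cost \<eta> in \<open>e\<close>.\<close>

lemma comp_Phi_eq_comp_leqd:
  assumes "x \<in> X" "y \<in> X"
  shows "comp_Phi X e d x y = comp_leqd X e d x y"
proof (rule antisym)
  show "comp_Phi X e d x y \<le> comp_leqd X e d x y"
    unfolding comp_Phi_def comp_leqd_def leqd_def
    by (intro SUP_least INF_superset_mono) auto
next
  have le: "comp_leqd X e d x y \<le> comp_Phi X e d x y + \<epsilon>"
    if \<epsilon>: "0 < \<epsilon>" and fin: "comp_Phi X e d x y < top" for \<epsilon>
  proof -
    obtain \<eta> where \<eta>: "0 < \<eta>" "\<eta> + \<eta> < \<epsilon>" using ennreal_half_gap[OF \<epsilon>] by blast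
    obtain \<delta> where \<delta>: "0 < \<delta>" "\<And>a. a \<in> X \<Longrightarrow> d a y < \<delta> \<Longrightarrow> \<exists>b\<in>X. d b y = 0 \<and> e a b < \<eta>"
      using leqd_near[OF \<eta>(1)] assms(2) by blast
    have "(INF z\<in>{z\<in>X. d z y < \<delta>}. e x z) \<le> comp_Phi X e d x y"
      unfolding comp_Phi_def using \<delta>(1) by (intro SUP_upper) auto
    \<comment> \<open>Adding \<eta> is strict at finite values only;
      \<open>ennreal_le_epsilon\<close> asks for nothing more.\<close>
    also have "\<dots> < comp_Phi X e d x y + \<eta>" 
      using \<eta>(1) fin ennreal_add_left_cancel_less[of "comp_Phi X e d x y" 0 \<eta>] by auto
    finally obtain z where z: "z \<in> X" "d z y < \<delta>" "e x z < comp_Phi X e d x y + \<eta>"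
      by (auto simp: INF_less_iff)
    then obtain b where b: "b \<in> X" "d b y = 0" "e z b < \<eta>" using \<delta>(2) by blast
    have "comp_leqd X e d x y \<le> e x b"
      unfolding comp_leqd_def leqd_def using b by (intro INF_lower) auto
    also have "\<dots> \<le> e x z + e z b" using tri_e assms z b by blast
    also have "\<dots> \<le> (comp_Phi X e d x y + \<eta>) + \<eta>" using z b by (intro add_mono) auto
    also have "\<dots> \<le> comp_Phi X e d x y + \<epsilon>" using \<eta>(2) by (simp add: add.assoc add_left_mono)
    finally show ?thesis .
  qed
  show "comp_leqd X e d x y \<le> comp_Phi X e d x y"
    by (rule ennreal_le_epsilon) (use le in \<open>auto simp: top.not_eq_extremum\<close>)
qed

section \<open>Finite chains, their downward correction, and dense sequences in subsets\<close>

text \<open>Entries beyond \<open>n\<close> are left free, so chains of all lengths share one type.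
  No link from an entry to itself is demanded, as \<open>d\<close> need not vanish on the
  diagonal.\<close>

definition chain :: "nat \<Rightarrow> (nat \<Rightarrow> 'a) \<Rightarrow> bool" where
  "chain n c \<longleftrightarrow> (\<forall>i\<le>n. c i \<in> X) \<and> (\<forall>i<n. d (c i) (c (Suc i)) = 0)"

text \<open>Correction runs from the top: the old top is replaced by an exact lower bound
  \<open>v\<close> of \<open>u\<close>, then the shorter chain is corrected to end at
  \<open>v\<close>. Since \<delta> depends on \<open>n\<close> and \<epsilon> alone,
  \<open>u\<close> can be chosen afterwards.\<close>

lemma chain_extend:
  assumes "0 < \<epsilon>"
  shows "\<exists>\<delta>>0. \<forall>c u. chain n c \<longrightarrow> u \<in> X \<longrightarrow> d (c n) u < \<delta> \<longrightarrow>
    (\<exists>c'. chain (Suc n) c' \<and> c' (Suc n) = u \<and> (\<forall>i\<le>n. e (c i) (c' i) < \<epsilon>))"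
proof (induction n)
  case 0
  obtain \<delta> where \<delta>: "0 < \<delta>"
    "\<And>u a. u \<in> X \<Longrightarrow> a \<in> X \<Longrightarrow> d a u < \<delta> \<Longrightarrow> \<exists>b\<in>X. d b u = 0 \<and> e a b < \<epsilon>"
    using leqd_near[OF assms] by blast
  have "\<exists>c'. chain (Suc 0) c' \<and> c' (Suc 0) = u \<and> (\<forall>i\<le>0. e (c i) (c' i) < \<epsilon>)"
    if "chain 0 c" "u \<in> X" "d (c 0) u < \<delta>" for c u
  proof -
    obtain b where "b \<in> X" "d b u = 0" "e (c 0) b < \<epsilon>"
      using \<delta>(2)[of u "c 0"] \<open>chain 0 c\<close> \<open>u \<in> X\<close> \<open>d (c 0) u < \<delta>\<close> by (auto simp: chain_def)
    then show ?thesis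
      using \<open>u \<in> X\<close> by (intro exI[of _ "\<lambda>i. if i = 0 then b else u"]) (auto simp: chain_def)
  qed
  then show ?case using \<delta>(1) by blast
next
  case (Suc n)
  then obtain \<delta>' where \<delta>': "0 < \<delta>'" "\<And>c u. chain n c \<Longrightarrow> u \<in> X \<Longrightarrow> d (c n) u < \<delta>' \<Longrightarrow>
      \<exists>c'. chain (Suc n) c' \<and> c' (Suc n) = u \<and> (\<forall>i\<le>n. e (c i) (c' i) < \<epsilon>)" by blast
  obtain \<kappa> where \<kappa>: "0 < \<kappa>" "\<And>a b. a \<in> X \<Longrightarrow> b \<in> X \<Longrightarrow> e a b < \<kappa> \<Longrightarrow> d a b < \<delta>'"
    using d_small[OF \<delta>'(1)] by blast
  \<comment> \<open>\<epsilon> keeps \<open>v\<close> close to the old top; \<kappa> brings the old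
    top, and through its zero link also \<open>c n\<close>, within the tolerance
    \<open>\<delta>'\<close> below \<open>v\<close>.\<close>
  have "0 < min \<epsilon> \<kappa>" using assms \<kappa>(1) by simp
  from leqd_near[OF this] obtain \<delta> where \<delta>: "0 < \<delta>"
    "\<And>u a. u \<in> X \<Longrightarrow> a \<in> X \<Longrightarrow> d a u < \<delta> \<Longrightarrow> \<exists>b\<in>X. d b u = 0 \<and> e a b < min \<epsilon> \<kappa>" by blast
  have "\<exists>c'. chain (Suc (Suc n)) c' \<and> c' (Suc (Suc n)) = u \<and> (\<forall>i\<le>Suc n. e (c i) (c' i) < \<epsilon>)"
    if c: "chain (Suc n) c" and u: "u \<in> X" "d (c (Suc n)) u < \<delta>" for c u
  proof -
    have cn: "chain n c" "c n \<in> X" "c (Suc n) \<in> X" "d (c n) (c (Suc n)) = 0"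
      using c by (auto simp: chain_def)
    obtain v where v: "v \<in> X" "d v u = 0" "e (c (Suc n)) v < \<epsilon>" "e (c (Suc n)) v < \<kappa>"
      using \<delta>(2)[OF u(1) cn(3) u(2)] by auto
    have "d (c n) v \<le> d (c (Suc n)) v" using tri_d[OF cn(2,3) v(1)] cn(4) by simp
    also have "\<dots> < \<delta>'" using \<kappa>(2) cn v by blast
    finally obtain c' where c': "chain (Suc n) c'" "c' (Suc n) = v" "\<And>i. i \<le> n \<Longrightarrow> e (c i) (c' i) < \<epsilon>"
      using \<delta>'(2)[OF cn(1) v(1)] by blast
    have "chain (Suc (Suc n)) (c'(Suc (Suc n) := u))"
      using c'(1,2) u(1) v(2) by (auto simp: chain_def less_Suc_eq le_Suc_eq)
    moreover have "e (c i) ((c'(Suc (Suc n) := u)) i) < \<epsilon>" if "i \<le> Suc n" for i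
      using that c'(2,3) v(3) by (auto simp: le_Suc_eq)
    ultimately show ?thesis by (intro exI[of _ "c'(Suc (Suc n) := u)"]) auto
  qed
  then show ?case using \<delta>(1) by blast
qed

text \<open>Points of the countable dense set may lie outside \<open>A\<close>, so for each of them
  and each scale a nearby point of \<open>A\<close> is selected if there is one. Symmetry of
  \<open>e\<close> allows the return from the dense point to the selected one.\<close>

lemma separable_dense_sequence:
  assumes "separable_on X e" "A \<subseteq> X" "A \<noteq> {}"
  shows "\<exists>w :: nat \<Rightarrow> 'a. range w \<subseteq> A \<and> (\<forall>a\<in>A. \<forall>\<epsilon>>0. \<exists>i. e a (w i) < \<epsilon>)"
proof -
  obtain Q where Q: "Q \<subseteq> X" "countable Q" "\<And>a. a \<in> X \<Longrightarrow> (INF q\<in>Q. e a q) = 0"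
    using assms(1) unfolding separable_on_def by blast
  define g where "g q n = (SOME a. a \<in> A \<and> e a q < dyadic n)" for q n
  define W where "W = {g q n |q n. q \<in> Q \<and> (\<exists>a\<in>A. e a q < dyadic n)}"
  have g: "g q n \<in> A \<and> e (g q n) q < dyadic n" if "a \<in> A" "e a q < dyadic n" for a q n
    unfolding g_def by (rule someI[of _ a]) (use that in blast)
  have "W \<subseteq> (\<lambda>(q, n). g q n) ` (Q \<times> UNIV)" by (auto simp: W_def)
  then have countable: "countable W" using Q(2) by (meson countable_SIGMA countable_image countable_subset countableI_type)
  have WA: "W \<subseteq> A" using g by (auto simp: W_def)
  have dense: "\<exists>w\<in>W. e a w < \<epsilon>" if a: "a \<in> A" and \<epsilon>: "0 < \<epsilon>" for a \<epsilon>
  proof -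
    obtain \<eta> where \<eta>: "0 < \<eta>" "\<eta> + \<eta> < \<epsilon>" using ennreal_half_gap[OF \<epsilon>] by blast
    obtain n where n: "dyadic n < \<eta>" using dyadic_less[OF \<eta>(1)] by blast
    have "(INF q\<in>Q. e a q) < dyadic n" using Q(3) a assms(2) dyadic_pos by auto
    then obtain q where q: "q \<in> Q" "e a q < dyadic n" by (auto simp: INF_less_iff)
    have gq: "g q n \<in> A" "e (g q n) q < dyadic n" using g[OF a q(2)] by auto
    have "e a (g q n) \<le> e a q + e q (g q n)" using tri_e a assms(2) gq(1) q(1) Q(1) by blast
    also have "\<dots> = e a q + e (g q n) q" using sym gq(1) assms(2) q(1) Q(1) by auto
    also have "\<dots> \<le> \<eta> + \<eta>" using n gq(2) q(2) by (intro add_mono) auto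
    also note \<eta>(2)
    finally show ?thesis using q a by (auto simp: W_def)
  qed
  then have "W \<noteq> {}" using assms(3) zero_less_one by blast
  then have "range (from_nat_into W) = W" using countable by (rule range_from_nat_into)
  then show ?thesis using WA dense by (intro exI[of _ "from_nat_into W"]) (metis imageE)
qed

end

section \<open>The limit function of the net and its zero set\<close>

locale cauchy_net_setup = complete_distance_pair X d e
  for X :: "'a set" and d e :: "'a \<Rightarrow> 'a \<Rightarrow> ennreal" +
  fixes \<Lambda> :: "'i set" and r :: "'i \<Rightarrow> 'i \<Rightarrow> bool" and x :: "'i \<Rightarrow> 'a"
  assumes net: "net_index \<Lambda> r" and xX: "x \<in> \<Lambda> \<rightarrow> X" and cauchy: "cauchy_net d \<Lambda> r x"
begin

text \<open>The limit of \<open>d y (x l)\<close>, written as an upper limit so that it is total;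
  only upper bounds on tails are ever extracted from it.\<close>

definition dlim :: "'a \<Rightarrow> ennreal" where
  "dlim y = Limsup (net_filter \<Lambda> r) (\<lambda>l. d y (x l))"

definition lower_set :: "'a set" where
  "lower_set = {y \<in> X. dlim y = 0}"

lemma lower_set_subset: "lower_set \<subseteq> X"
  by (auto simp: lower_set_def)

lemma eventually_in_X: "eventually (\<lambda>l. x l \<in> X) (net_filter \<Lambda> r)"
  unfolding eventually_net_filter[OF net] using net xX by (auto simp: net_index_def)

lemma dlim_lessD: "dlim y < t \<Longrightarrow> eventually (\<lambda>l. d y (x l) < t) (net_filter \<Lambda> r)"
  unfolding dlim_def by (rule Limsup_lessD)

lemma dlim_leI: "eventually (\<lambda>l. d y (x l) \<le> t) (net_filter \<Lambda> r) \<Longrightarrow> dlim y \<le> t"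
  unfolding dlim_def by (rule Limsup_bounded)

text \<open>Supplies the hypothesis \<open>lower\<close> of \<open>zero_near\<close>, and shows that
  exact \<open>d\<close>-lower bounds of members of \<open>lower_set\<close> are again
  members.\<close>

lemma dlim_triangle:
  assumes "a \<in> X" "b \<in> X"
  shows "dlim a \<le> d a b + dlim b"
proof (rule ennreal_le_epsilon)
  fix \<epsilon> :: real assume "d a b + dlim b < top" "0 < \<epsilon>"
  then have "dlim b < dlim b + ennreal \<epsilon>"
    using ennreal_add_left_cancel_less[of "dlim b" 0 "ennreal \<epsilon>"] by auto
  from dlim_lessD[OF this] eventually_in_X
  have "eventually (\<lambda>l. d a (x l) \<le> d a b + dlim b + ennreal \<epsilon>) (net_filter \<Lambda> r)"
  proof eventually_elim
    case (elim l)
    have "d a (x l) \<le> d a b + d b (x l)" using tri_d assms elim by blast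
    also have "\<dots> \<le> d a b + (dlim b + ennreal \<epsilon>)" using elim by (intro add_mono) auto
    finally show ?case by (simp add: add.assoc)
  qed
  then show "dlim a \<le> d a b + dlim b + ennreal \<epsilon>" by (rule dlim_leI)
qed

lemma eventually_dlim_small:
  assumes "0 < \<epsilon>"
  shows "eventually (\<lambda>l. dlim (x l) < \<epsilon>) (net_filter \<Lambda> r)"
proof -
  obtain \<eta> where \<eta>: "0 < \<eta>" "\<eta> < \<epsilon>" using dense[OF assms] by blast
  then obtain \<alpha> where \<alpha>: "\<alpha> \<in> \<Lambda>"
    "\<And>\<gamma> \<delta>. \<gamma> \<in> \<Lambda> \<Longrightarrow> \<delta> \<in> \<Lambda> \<Longrightarrow> r \<alpha> \<gamma> \<Longrightarrow> r \<gamma> \<delta> \<Longrightarrow> d (x \<gamma>) (x \<delta>) < \<eta>"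
    using cauchy unfolding cauchy_net_def by blast
  have "dlim (x \<gamma>) < \<epsilon>" if "\<gamma> \<in> \<Lambda>" "r \<alpha> \<gamma>" for \<gamma>
  proof -
    have "dlim (x \<gamma>) \<le> \<eta>"
      by (rule dlim_leI, unfold eventually_net_filter[OF net]) (use \<alpha>(2) that in \<open>blast intro: less_imp_le\<close>)
    then show ?thesis using \<eta>(2) by simp
  qed
  then show ?thesis unfolding eventually_net_filter[OF net] using \<alpha>(1) by blast
qed

text \<open>\<open>zero_near\<close> for the single function \<open>dlim\<close>. Its approximation
  hypothesis goes through a late net point: \<open>a\<close> is moved slightly to some
  \<open>c\<close> almost below \<open>x l\<close>, and \<open>dlim (x l)\<close> is itself
  small.\<close>

lemma lower_set_near:
  assumes "0 < \<epsilon>"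
  shows "\<exists>\<delta>>0. \<forall>a\<in>X. dlim a < \<delta> \<longrightarrow> (\<exists>b\<in>lower_set. e a b < \<epsilon>)"
proof -
  have "\<exists>\<delta>>0. \<forall>t\<in>{()}. \<forall>a\<in>X. dlim a < \<delta> \<longrightarrow> (\<exists>b\<in>X. dlim b = 0 \<and> e a b < \<epsilon>)"
  proof (rule zero_near[OF _ _ assms])
    fix \<epsilon> :: ennreal assume "0 < \<epsilon>"
    then obtain \<delta> where \<delta>: "0 < \<delta>" "\<And>a b \<eta>. a \<in> X \<Longrightarrow> b \<in> X \<Longrightarrow> d a b < \<delta> \<Longrightarrow> 0 < \<eta> \<Longrightarrow>
        \<exists>c\<in>X. d c b < \<eta> \<and> e a c < \<epsilon>"
      using Phi_small by blast
    have "\<exists>b\<in>X. dlim b < \<eta> \<and> e a b < \<epsilon>" if a: "a \<in> X" "dlim a < \<delta>" and \<eta>: "0 < \<eta>" for a \<eta>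
    proof -
      obtain \<kappa> where \<kappa>: "0 < \<kappa>" "\<kappa> + \<kappa> < \<eta>" using ennreal_half_gap[OF \<eta>] by blast
      have "eventually (\<lambda>l. d a (x l) < \<delta> \<and> dlim (x l) < \<kappa> \<and> x l \<in> X) (net_filter \<Lambda> r)"
        using dlim_lessD[OF a(2)] eventually_dlim_small[OF \<kappa>(1)] eventually_in_X
        by eventually_elim blast
      then obtain l where l: "d a (x l) < \<delta>" "dlim (x l) < \<kappa>" "x l \<in> X"
        using eventually_happens'[OF net_filter_neq_bot[OF net]] by blast
      obtain c where c: "c \<in> X" "d c (x l) < \<kappa>" "e a c < \<epsilon>"
        using \<delta>(2)[OF a(1) l(3,1) \<kappa>(1)] by blast
      have "dlim c \<le> d c (x l) + dlim (x l)" using dlim_triangle c l by blast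
      also have "\<dots> \<le> \<kappa> + \<kappa>" using c l by (intro add_mono) auto
      also note \<kappa>(2)
      finally show ?thesis using c by blast
    qed
    then show "\<exists>\<delta>>0. \<forall>t\<in>{()}. \<forall>a\<in>X. dlim a < \<delta> \<longrightarrow> (\<forall>\<eta>>0. \<exists>b\<in>X. dlim b < \<eta> \<and> e a b < \<epsilon>)"
      using \<delta>(1) by blast
  qed (rule dlim_triangle)
  then show ?thesis unfolding lower_set_def by blast
qed

lemma lower_set_below:
  assumes "y \<in> lower_set" "0 < \<epsilon>"
  shows "eventually (\<lambda>l. d y (x l) < \<epsilon>) (net_filter \<Lambda> r)"
  using assms by (intro dlim_lessD) (simp add: lower_set_def)

text \<open>Late net points have small \<open>dlim\<close>, so they are \<open>e\<close>-close,
  hence \<open>d\<close>-close, to its zero set.\<close>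

lemma lower_set_above:
  assumes "0 < \<epsilon>"
  shows "eventually (\<lambda>l. \<exists>y\<in>lower_set. d (x l) y < \<epsilon>) (net_filter \<Lambda> r)"
proof -
  obtain \<kappa> where \<kappa>: "0 < \<kappa>" "\<And>a b. a \<in> X \<Longrightarrow> b \<in> X \<Longrightarrow> e a b < \<kappa> \<Longrightarrow> d a b < \<epsilon>"
    using d_small[OF assms] by blast
  obtain \<delta> where \<delta>: "0 < \<delta>" "\<And>a. a \<in> X \<Longrightarrow> dlim a < \<delta> \<Longrightarrow> \<exists>b\<in>lower_set. e a b < \<kappa>"
    using lower_set_near[OF \<kappa>(1)] by blast
  show ?thesis
    using eventually_dlim_small[OF \<delta>(1)] eventually_in_X
    by eventually_elim (use \<delta>(2) \<kappa>(2) lower_set_subset in blast)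
qed

lemma same_net_limits_lower_set: "same_net_limits X d \<Lambda> r x lower_set"
  by (rule same_net_limitsI[OF dist_d net xX lower_set_subset lower_set_below lower_set_above])

text \<open>Finitely many tail conditions hold together at a late net point, and some member of
  \<open>lower_set\<close> lies almost above that point.\<close>

lemma lower_set_finite_bound:
  assumes "finite F" "F \<subseteq> lower_set" "0 < \<epsilon>"
  shows "\<exists>y\<in>lower_set. \<forall>z\<in>F. d z y < \<epsilon>"
proof -
  obtain \<eta> where \<eta>: "0 < \<eta>" "\<eta> + \<eta> < \<epsilon>" using ennreal_half_gap[OF assms(3)] by blast
  have "eventually (\<lambda>l. \<forall>z\<in>F. d z (x l) < \<eta>) (net_filter \<Lambda> r)"
    using assms(2) lower_set_below[OF _ \<eta>(1)] by (intro eventually_ball_finite assms(1)) blast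
  then have "eventually (\<lambda>l. (\<forall>z\<in>F. d z (x l) < \<eta>) \<and> x l \<in> X \<and> (\<exists>y\<in>lower_set. d (x l) y < \<eta>)) (net_filter \<Lambda> r)"
    using eventually_in_X lower_set_above[OF \<eta>(1)] by eventually_elim blast
  then obtain l y where l: "\<And>z. z \<in> F \<Longrightarrow> d z (x l) < \<eta>" "x l \<in> X" "y \<in> lower_set" "d (x l) y < \<eta>"
    using eventually_happens'[OF net_filter_neq_bot[OF net]] by blast
  have "d z y < \<epsilon>" if "z \<in> F" for z
  proof -
    have "d z y \<le> d z (x l) + d (x l) y" using tri_d l lower_set_subset assms(2) that by blast
    also have "\<dots> \<le> \<eta> + \<eta>" using l that by (intro add_mono) (auto intro: less_imp_le)
    finally show ?thesis using \<eta>(2) by simp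
  qed
  then show ?thesis using l(3) by blast
qed

lemma d_directed_lower_set: "d_directed d lower_set"
  unfolding d_directed_def
proof (intro allI impI, rule ennreal_zero_if_le_all)
  fix F and \<epsilon> :: ennreal assume "F \<subseteq> lower_set" "finite F" "0 < \<epsilon>"
  then obtain y where y: "y \<in> lower_set" "\<And>z. z \<in> F \<Longrightarrow> d z y < \<epsilon>"
    using lower_set_finite_bound[of F \<epsilon>] by blast
  have "(INF y\<in>lower_set. SUP z\<in>F. d z y) \<le> (SUP z\<in>F. d z y)" using y(1) by (rule INF_lower)
  also have "\<dots> \<le> \<epsilon>" using y(2) by (intro SUP_least) (simp add: less_imp_le)
  finally show "(INF y\<in>lower_set. SUP z\<in>F. d z y) \<le> \<epsilon>" .
qed

lemma lower_set_nonempty: "lower_set \<noteq> {}"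
  using lower_set_finite_bound[of "{}" 1] by auto

section \<open>The separable case: an increasing cofinal sequence\<close>

lemma ex_chain_array:
  fixes w :: "nat \<Rightarrow> 'a"
  assumes "range w \<subseteq> lower_set"
  shows "\<exists>C. \<forall>m. (chain m (C m) \<and> C m m \<in> lower_set) \<and> (\<forall>i\<le>m. e (C m i) (C (Suc m) i) < dyadic m) \<and>
    (\<forall>i\<le>m. d (w i) (C (Suc m) (Suc m)) < dyadic m)"
proof -
  have "\<exists>C. \<forall>m. (chain m (C m) \<and> C m m \<in> lower_set) \<and> ((\<forall>i\<le>m. e (C m i) (C (Suc m) i) < dyadic m) \<and>
    (\<forall>i\<le>m. d (w i) (C (Suc m) (Suc m)) < dyadic m))"
  proof (rule dependent_nat_choice)
    obtain y where "y \<in> lower_set" using lower_set_nonempty by blast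
    then show "\<exists>c. chain 0 c \<and> c 0 \<in> lower_set"
      using lower_set_subset by (intro exI[of _ "\<lambda>_. y"]) (auto simp: chain_def)
  next
    fix c m assume c: "chain m c \<and> c m \<in> lower_set"
    obtain \<delta> where \<delta>: "0 < \<delta>" "\<And>u. u \<in> X \<Longrightarrow> d (c m) u < \<delta> \<Longrightarrow>
        \<exists>c'. chain (Suc m) c' \<and> c' (Suc m) = u \<and> (\<forall>i\<le>m. e (c i) (c' i) < dyadic m)"
      using chain_extend[OF dyadic_pos, of m m] c by blast
    \<comment> \<open>One new top serves two purposes: \<delta> makes the old chain correctable
      below it, and \<open>dyadic m\<close> puts it almost above
      \<open>w 0, ..., w m\<close>.\<close>
    have "\<exists>u\<in>lower_set. \<forall>z\<in>insert (c m) (w ` {..m}). d z u < min \<delta> (dyadic m)"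
      by (rule lower_set_finite_bound) (use c assms \<delta>(1) dyadic_pos in auto)
    then obtain u where u: "u \<in> lower_set" "d (c m) u < \<delta>" "\<forall>i\<le>m. d (w i) u < dyadic m" by auto
    then obtain c' where "chain (Suc m) c'" "c' (Suc m) = u" "\<forall>i\<le>m. e (c i) (c' i) < dyadic m"
      using \<delta>(2) lower_set_subset by blast
    then show "\<exists>c'. (chain (Suc m) c' \<and> c' (Suc m) \<in> lower_set) \<and>
        (\<forall>i\<le>m. e (c i) (c' i) < dyadic m) \<and> (\<forall>i\<le>m. d (w i) (c' (Suc m)) < dyadic m)"
      using u by auto
  qed
  then show ?thesis .
qed

lemma ex_increasing_cofinal_sequence:
  assumes "separable_on X e"
  shows "\<exists>y :: nat \<Rightarrow> 'a. range y \<subseteq> lower_set \<and> (\<forall>i. d (y i) (y (Suc i)) = 0) \<and>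
    (\<forall>a\<in>lower_set. \<forall>\<epsilon>>0. \<exists>i. d a (y i) < \<epsilon>)"
proof -
  obtain w :: "nat \<Rightarrow> 'a" where w: "range w \<subseteq> lower_set"
      "\<And>a \<epsilon>. a \<in> lower_set \<Longrightarrow> 0 < \<epsilon> \<Longrightarrow> \<exists>i. e a (w i) < \<epsilon>"
    using separable_dense_sequence[OF assms lower_set_subset lower_set_nonempty] by metis
  obtain C where C: "\<And>m. chain m (C m)" "\<And>m. C m m \<in> lower_set"
      "\<And>m i. i \<le> m \<Longrightarrow> e (C m i) (C (Suc m) i) < dyadic m"
      "\<And>m i. i \<le> m \<Longrightarrow> d (w i) (C (Suc m) (Suc m)) < dyadic m"
    using ex_chain_array[OF w(1)] by metis
  have CX: "C m i \<in> X" if "i \<le> m" for m i using C(1)[of m] that by (simp add: chain_def)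
  \<comment> \<open>Column \<open>i\<close> begins at row \<open>i\<close>, hence the shift by
    \<open>i\<close>.\<close>
  have "\<exists>p\<in>X. \<forall>n. e (C (i + n) i) p \<le> dyadic (i + n) + dyadic (i + n)" for i
    by (rule dyadic_sequence_limit) (use CX C(3) in \<open>auto intro: less_imp_le\<close>)
  then obtain y where yX: "\<And>i. y i \<in> X"
    and y': "\<And>i n. e (C (i + n) i) (y i) \<le> dyadic (i + n) + dyadic (i + n)" by metis
  have y: "e (C m i) (y i) \<le> dyadic m + dyadic m" if "i \<le> m" for m i
    using y'[of i "m - i"] that by simp
  \<comment> \<open>One \<open>N\<close> serves all columns, because the bound on
    \<open>e (C m i) (y i)\<close> depends on the row alone; cofinality below uses this on the
    diagonal.\<close>
  have conv: "\<exists>N. \<forall>m i. N \<le> m \<longrightarrow> i \<le> m \<longrightarrow> d (C m i) (y i) < \<epsilon> \<and> d (y i) (C m i) < \<epsilon>" if "0 < \<epsilon>" for \<epsilon>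
  proof -
    obtain \<kappa> where \<kappa>: "0 < \<kappa>" "\<And>a b. a \<in> X \<Longrightarrow> b \<in> X \<Longrightarrow> e a b < \<kappa> \<Longrightarrow> d a b < \<epsilon> \<and> d b a < \<epsilon>"
      using d_small[OF \<open>0 < \<epsilon>\<close>] by blast
    have "(\<lambda>m. dyadic m + dyadic m) \<longlonglongrightarrow> 0 + 0" by (intro tendsto_add dyadic_tendsto)
    then have "eventually (\<lambda>m. dyadic m + dyadic m < \<kappa>) sequentially"
      using \<kappa>(1) by (intro order_tendstoD(2)) simp_all
    then obtain N where "\<And>m. N \<le> m \<Longrightarrow> dyadic m + dyadic m < \<kappa>"
      by (auto simp: eventually_sequentially)
    then have "d (C m i) (y i) < \<epsilon> \<and> d (y i) (C m i) < \<epsilon>" if "N \<le> m" "i \<le> m" for m i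
      using that by (intro \<kappa>(2) CX yX le_less_trans[OF y]) auto
    then show ?thesis by blast
  qed
  \<comment> \<open>The case \<open>k = 0\<close> is excluded because a point may have positive
    distance to itself.\<close>
  have chain0: "d (C m i) (C m (i + k)) = 0" if "i + k \<le> m" "k \<noteq> 0" for m i k
    using that
  proof (induction k)
    case (Suc k)
    have step: "d (C m (i + k)) (C m (i + Suc k)) = 0" using C(1)[of m] Suc.prems by (simp add: chain_def)
    show ?case
    proof (cases "k = 0")
      case False
      then show ?thesis
        using tri_d[of "C m i" "C m (i + k)" "C m (i + Suc k)"] CX[of _ m] Suc step by simp
    qed (use step in simp)
  qed simp
  have "y i \<in> lower_set" for i
  proof -
    have "dlim (y i) \<le> \<epsilon>" if \<epsilon>: "0 < \<epsilon>" for \<epsilon>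
    proof -
      obtain N where N: "\<And>m j. N \<le> m \<Longrightarrow> j \<le> m \<Longrightarrow> d (y j) (C m j) < \<epsilon>" using conv[OF \<epsilon>] by blast
      \<comment> \<open>The row lies beyond \<open>i\<close>, so that \<open>C m i\<close> comes
        strictly before the top \<open>C m m\<close> and \<open>chain0\<close> applies.\<close>
      define m where "m = max N (Suc i)"
      have m: "N \<le> m" "i \<le> m" by (auto simp: m_def)
      have "dlim (C m i) \<le> d (C m i) (C m m) + dlim (C m m)" using dlim_triangle CX by (simp add: m_def)
      also have "\<dots> = 0" using chain0[of i "m - i" m] C(2)[of m] by (simp add: m_def lower_set_def)
      finally have "dlim (C m i) = 0" by simp
      then have "dlim (y i) \<le> d (y i) (C m i)" using dlim_triangle[OF yX CX[OF m(2)], of i] by simp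
      also have "\<dots> \<le> \<epsilon>" using N[OF m] by (rule less_imp_le)
      finally show ?thesis .
    qed
    then have "dlim (y i) = 0" by (rule ennreal_zero_if_le_all)
    then show ?thesis using yX by (simp add: lower_set_def)
  qed
  moreover have "d (y i) (y (Suc i)) = 0" for i
  proof (rule ennreal_zero_if_le_all)
    fix \<epsilon> :: ennreal assume "0 < \<epsilon>"
    then obtain \<eta> where \<eta>: "0 < \<eta>" "\<eta> + \<eta> < \<epsilon>" using ennreal_half_gap by blast
    obtain N where N: "\<And>m j. N \<le> m \<Longrightarrow> j \<le> m \<Longrightarrow> d (C m j) (y j) < \<eta> \<and> d (y j) (C m j) < \<eta>"
      using conv[OF \<eta>(1)] by blast
    define m where "m = max N (Suc i)"
    have m: "N \<le> m" "i \<le> m" "Suc i \<le> m" by (auto simp: m_def)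
    \<comment> \<open>The detour stays in one late row, where the two columns are joined by a zero
      link.\<close>
    have "d (y i) (y (Suc i)) \<le> d (y i) (C m i) + d (C m i) (y (Suc i))"
      using tri_d yX CX m by blast
    also have "d (C m i) (y (Suc i)) \<le> d (C m i) (C m (Suc i)) + d (C m (Suc i)) (y (Suc i))"
      using tri_d yX CX m by blast
    also have "d (C m i) (C m (Suc i)) = 0" using chain0[of i 1 m] m by simp
    also have "d (y i) (C m i) + (0 + d (C m (Suc i)) (y (Suc i))) \<le> \<eta> + \<eta>"
      using N m by (intro add_mono) (auto intro: less_imp_le)
    finally show "d (y i) (y (Suc i)) \<le> \<epsilon>" using \<eta>(2) by (auto simp: add_left_mono)
  qed
  moreover have "\<exists>i. d a (y i) < \<epsilon>" if a: "a \<in> lower_set" and "0 < \<epsilon>" for a \<epsilon>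
  proof -
    obtain \<eta> where \<eta>: "0 < \<eta>" "\<eta> + \<eta> < \<epsilon>" using ennreal_half_gap[OF \<open>0 < \<epsilon>\<close>] by blast
    obtain \<theta> where \<theta>: "0 < \<theta>" "\<theta> + \<theta> < \<eta>" using ennreal_half_gap[OF \<eta>(1)] by blast
    obtain \<kappa> where \<kappa>: "0 < \<kappa>" "\<And>a b. a \<in> X \<Longrightarrow> b \<in> X \<Longrightarrow> e a b < \<kappa> \<Longrightarrow> d a b < \<eta>"
      using d_small[OF \<eta>(1)] by blast
    obtain j where "e a (w j) < \<kappa>" using w(2)[OF a \<kappa>(1)] by blast
    moreover have aX: "a \<in> X" and wX: "w j \<in> X" using a w(1) lower_set_subset by auto
    ultimately have 1: "d a (w j) < \<eta>" using \<kappa>(2) by blast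
    obtain N where N: "\<And>m i. N \<le> m \<Longrightarrow> i \<le> m \<Longrightarrow> d (C m i) (y i) < \<theta>" using conv[OF \<theta>(1)] by blast
    obtain N' where N': "\<And>m. N' \<le> m \<Longrightarrow> dyadic m < \<theta>"
      using order_tendstoD(2)[OF dyadic_tendsto \<theta>(1)] by (auto simp: eventually_sequentially)
    \<comment> \<open>\<open>j\<close> ensures that the top of row \<open>Suc m\<close> was chosen
      with \<open>w j\<close> in view, \<open>N'\<close> makes that error small, and
      \<open>N\<close> controls passing from this top to the limit of its own column.\<close>
    define m where "m = max (max N N') j"
    have m: "N \<le> Suc m" "N' \<le> m" "j \<le> m" by (auto simp: m_def)
    let ?u = "C (Suc m) (Suc m)"
    have "d (w j) (y (Suc m)) \<le> d (w j) ?u + d ?u (y (Suc m))" using tri_d wX CX yX by blast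
    also have "\<dots> \<le> \<theta> + \<theta>"
      using C(4)[OF m(3)] N'[OF m(2)] N[OF m(1) order_refl] by (intro add_mono) auto
    finally have "d (w j) (y (Suc m)) \<le> \<eta>" using \<theta>(2) by simp
    then have "d a (w j) + d (w j) (y (Suc m)) \<le> \<eta> + \<eta>" using 1 by (intro add_mono) auto
    then have "d a (y (Suc m)) < \<epsilon>" using tri_d[OF aX wX yX, of "Suc m"] \<eta>(2) by auto
    then show ?thesis by blast
  qed
  ultimately show ?thesis by blast
qed

text \<open>The limits are inherited from \<open>lower_set\<close>, since the sequence lies in it
  and is cofinal there up to any \<epsilon>.\<close>

lemma ex_leqd_directed:
  assumes "separable_on X e"
  shows "\<exists>Y\<subseteq>X. leqd_directed d Y \<and> same_net_limits X d \<Lambda> r x Y"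
proof -
  obtain y :: "nat \<Rightarrow> 'a" where y: "\<And>i. y i \<in> lower_set" "\<And>i. d (y i) (y (Suc i)) = 0"
      "\<And>a \<epsilon>. a \<in> lower_set \<Longrightarrow> 0 < \<epsilon> \<Longrightarrow> \<exists>i. d a (y i) < \<epsilon>"
    using ex_increasing_cofinal_sequence[OF assms] by (metis rangeI subsetD)
  have yX: "y i \<in> X" for i using y(1) lower_set_subset by blast
  have "d (y i) (y (Suc (i + k))) = 0" for i k
  proof (induction k)
    case (Suc k)
    then show ?case using tri_d[OF yX yX yX, of i "Suc (Suc (i + k))" "Suc (i + k)"] y(2) by simp
  qed (simp add: y(2))
  then have incr: "d (y i) (y j) = 0" if "i < j" for i j
    using that less_imp_Suc_add by blast
  have "leqd_directed d (range y)"
    unfolding leqd_directed_def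
  proof (intro allI impI)
    fix F assume "F \<subseteq> range y" "finite F"
    then obtain I where I: "finite I" "F = y ` I" by (meson finite_subset_image)
    \<comment> \<open>The index must exceed every member of \<open>I\<close>, as \<open>leqd\<close>
      need not be reflexive; for empty \<open>I\<close> any index works.\<close>
    then have "i < Suc (Max I)" if "i \<in> I" for i using that by (simp add: less_Suc_eq_le)
    then show "\<exists>u\<in>range y. \<forall>z\<in>F. leqd d z u"
      using I(2) incr by (intro bexI[of _ "y (Suc (Max I))"]) (auto simp: leqd_def)
  qed
  moreover have "same_net_limits X d \<Lambda> r x (range y)"
  proof (rule same_net_limitsI[OF dist_d net xX])
    show "range y \<subseteq> X" using yX by blast
    show "eventually (\<lambda>l. d z (x l) < \<epsilon>) (net_filter \<Lambda> r)" if "z \<in> range y" "0 < \<epsilon>" for z \<epsilon>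
      using that y(1) lower_set_below by blast
    show "eventually (\<lambda>l. \<exists>z\<in>range y. d (x l) z < \<epsilon>) (net_filter \<Lambda> r)" if \<epsilon>: "0 < \<epsilon>" for \<epsilon>
    proof -
      obtain \<eta> where \<eta>: "0 < \<eta>" "\<eta> + \<eta> < \<epsilon>" using ennreal_half_gap[OF \<epsilon>] by blast
      show ?thesis using eventually_in_X lower_set_above[OF \<eta>(1)]
      proof eventually_elim
        case (elim l)
        then obtain a where a: "a \<in> lower_set" "d (x l) a < \<eta>" by blast
        obtain i where i: "d a (y i) < \<eta>" using y(3)[OF a(1) \<eta>(1)] by blast
        have "d (x l) (y i) \<le> d (x l) a + d a (y i)" using tri_d elim a lower_set_subset yX by blast
        also have "\<dots> \<le> \<eta> + \<eta>" using a i by (intro add_mono) auto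
        also note \<eta>(2)
        finally show ?case by blast
      qed
    qed
  qed
  ultimately show ?thesis using yX by blast
qed

end

theorem theorem3:
  fixes X :: "'a set" and d e :: "'a \<Rightarrow> 'a \<Rightarrow> ennreal"
    and \<Lambda> :: "'i set" and r :: "'i \<Rightarrow> 'i \<Rightarrow> bool" and x :: "'i \<Rightarrow> 'a"
  assumes "distance_on X d" and "distance_on X e"
    and "net_index \<Lambda> r" and "x \<in> \<Lambda> \<rightarrow> X" and "cauchy_net d \<Lambda> r x"
    and "complete_on X e"
    and "precapprox_on (X \<times> X) (\<lambda>(a, b). comp_Phi X e d a b) (\<lambda>(a, b). d a b)"
    and "precapprox_on (X \<times> X) (\<lambda>(a, b). d a b) (\<lambda>(a, b). e a b)"
    and "\<forall>a\<in>X. \<forall>b\<in>X. e a b = e b a"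
  shows "(\<forall>a\<in>X. \<forall>b\<in>X. comp_Phi X e d a b = comp_leqd X e d a b) \<and>
    (\<exists>Y\<subseteq>X. d_directed d Y \<and> same_net_limits X d \<Lambda> r x Y) \<and>
    (separable_on X e \<longrightarrow>
      (\<exists>Y\<subseteq>X. d_directed d Y \<and> leqd_directed d Y \<and> same_net_limits X d \<Lambda> r x Y))"
proof -
  interpret cauchy_net_setup X d e \<Lambda> r x
    by unfold_locales (fact assms)+
  show ?thesis
    using comp_Phi_eq_comp_leqd d_directed_lower_set same_net_limits_lower_set lower_set_subset
      ex_leqd_directed leqd_directed_imp_d_directed
    by blast
qed

end
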